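(* Let $a,b$ be positive integers and let $\lambda=(\lambda_1,\lambda_2,\dots)$ be any partition of $b$ (with $\lambda_i=0$ for $i>l(\lambda)$), with conjugate $\lambda'=(\lambda'_1,\lambda'_2,\dots)$. Put $Y_0=0$ and $Y_i=\sum_{j=1}^i\lambda_j$ for $i\ge1$, and $$F_\lambda(q)=q^{2\sum_{i\geq 1}\binom{\lambda_i}{2}} \prod_{j\geq 1} \binom{j(a+2)-Y_{j-1}-Y_{j+1}}{\lambda_j-\lambda_{j+1}}_q .$$ Then $F_\lambda(q)$ is the generating function (by size) for all $\lambda_1$-modular diagrams $\Lambda$ of length $b$, contained inside an $a\times b$ rectangle, satisfying the following conditions: (1) $\Lambda$ has exactly $\lambda'_i$ rows labeled $i$, for each $i\ge1$; (2) if $\Sigma_i$ denotes the sum of the lengths of all rows of $\Lambda$ labeled $i$, then for every positive integer $j$, $$\Sigma_{\lambda_{j+1}+1}\leq \Sigma_{\lambda_{j+1}+2}\leq \dots \leq \Sigma_{\lambda_j}\leq j(a+1+\lambda_j+\lambda_{j+1}) -2Y_j$$ (this condition being empty when $\lambda_j=\lambda_{j+1}$); (3) for every positive integer $j$, every row labeled with an integer between $\lambda_{j+1}+1$ and $\lambda_j$ has length at least $\lambda_j+\lambda_{j+1}-1$; (4) for each label, the lengths of the longest and the shortest row carrying that label differ by at most $1$.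
   Context: $\binom{n}{k}_q$ denotes the Gaussian polynomial ($q$-binomial coefficient) $\frac{(1-q)\cdots(1-q^n)}{(1-q)\cdots(1-q^k)(1-q)\cdots(1-q^{n-k})}$. A partition is a weakly decreasing sequence of nonnegative integers with finitely many nonzero terms (its parts); $l(\lambda)$ is the number of parts, and $\lambda'$ is the conjugate partition. Modular diagrams (nonstandard definition): Fix a partition $\mu$ and positive integers $k\ge l(\mu)$ and $N$. An $N$-modular diagram of length $k$ consists of $k$ rows, the $i$-th row having length $\mu_i\ge 0$ (so rows of length zero are allowed), drawn as the Ferrers diagram of $\mu$ to which a zeroth column of $k$ cells has been added on the left (so row $i$ has $\mu_i+1$ cells, its zeroth cell plus $\mu_i$ further cells). Every cell is labeled with an integer between $1$ and $N$, every cell of a row other than its rightmost cell is labeled $N$, and the labels in each column are weakly decreasing from top to bottom. A row is said to be labeled $i$ if its rightmost cell (which is the zeroth cell when the row has length zero) is labeled $i$. The length of a row is $\mu_i$ (the zeroth cell is not counted), and the size of the diagram is $|\mu|=\sum_i\mu_i$; generating functions count diagrams by $q^{\text{size}}$. The diagram is contained inside an $a\times b$ rectangle if it has length $k=b$ and all row lengths are at most $a$. *)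

theory Defs
  imports "HOL-Computational_Algebra.Computational_Algebra"
begin

text \<open>
  A partition is a sequence indexed by the positive integers; its value at index \<open>0\<close>
  is never used.
\<close>

definition is_partition :: "(nat \<Rightarrow> nat) \<Rightarrow> bool" where
  "is_partition lam \<longleftrightarrow>
     (\<forall>i\<ge>1. lam (i + 1) \<le> lam i) \<and> finite {i. 1 \<le> i \<and> lam i \<noteq> 0}"

definition num_parts :: "(nat \<Rightarrow> nat) \<Rightarrow> nat" where
  "num_parts lam = card {i. 1 \<le> i \<and> lam i \<noteq> 0}"

definition partial_sum :: "(nat \<Rightarrow> nat) \<Rightarrow> nat \<Rightarrow> nat" where
  "partial_sum lam i = (\<Sum>j = 1..i. lam j)"

definition is_partition_of :: "(nat \<Rightarrow> nat) \<Rightarrow> nat \<Rightarrow> bool" where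
  "is_partition_of lam b \<longleftrightarrow> is_partition lam \<and> partial_sum lam (num_parts lam) = b"

definition conjugate :: "(nat \<Rightarrow> nat) \<Rightarrow> nat \<Rightarrow> nat" where
  "conjugate lam i = card {j. 1 \<le> j \<and> i \<le> lam j}"

text \<open>
  Polynomials in \<open>q\<close> are regarded as elements of \<open>rat fps\<close>, where \<open>q\<close> is \<open>fps_X\<close>
  and all denominators below are units.  The top entry of a Gaussian polynomial is an
  integer, since the expressions occurring as top entries can be negative.  As usual, the
  coefficient is \<open>0\<close> when the top entry is smaller than a positive bottom entry, and it is
  \<open>1\<close> whenever the bottom entry is \<open>0\<close>.
\<close>

definition q_poch :: "nat \<Rightarrow> rat fps" where
  "q_poch n = (\<Prod>i = 1..n. 1 - fps_X ^ i)"

definition gauss_poly :: "int \<Rightarrow> nat \<Rightarrow> rat fps" where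
  "gauss_poly n k =
     (if k = 0 then 1
      else if n < int k then 0
      else q_poch (nat n) / (q_poch k * q_poch (nat n - k)))"

text \<open>
  In the product over all \<open>j \<ge> 1\<close> the factors with \<open>j > num_parts lam\<close> have bottom
  entry \<open>0\<close>, hence are equal to \<open>1\<close>; likewise the terms of the sum in the exponent vanish there.
\<close>

definition F_poly :: "nat \<Rightarrow> (nat \<Rightarrow> nat) \<Rightarrow> rat fps" where
  "F_poly a lam =
     fps_X ^ (2 * (\<Sum>i = 1..num_parts lam. lam i choose 2)) *
     (\<Prod>j = 1..num_parts lam.
        gauss_poly
          (int j * (int a + 2) - int (partial_sum lam (j - 1)) - int (partial_sum lam (j + 1)))
          (lam j - lam (j + 1)))"

text \<open>
  A diagram is the list of its rows from top to bottom, each row being the list of its labels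
  from left to right, starting with the zeroth cell.  So \<open>D ! r ! c\<close> is the label of the cell
  in row \<open>r\<close> (counted from \<open>0\<close>) and column \<open>c\<close>.
\<close>

type_synonym diagram = "nat list list"

definition row_len :: "diagram \<Rightarrow> nat \<Rightarrow> nat" where
  "row_len D r = length (D ! r) - 1"

definition row_label :: "diagram \<Rightarrow> nat \<Rightarrow> nat" where
  "row_label D r = last (D ! r)"

definition modular_diagram :: "nat \<Rightarrow> nat \<Rightarrow> diagram \<Rightarrow> bool" where
  "modular_diagram N k D \<longleftrightarrow>
     length D = k \<and>
     (\<forall>r<k. D ! r \<noteq> []) \<and>
     (\<forall>r s. r < s \<and> s < k \<longrightarrow> row_len D s \<le> row_len D r) \<and>
     (\<forall>r<k. \<forall>c\<le>row_len D r. 1 \<le> D ! r ! c \<and> D ! r ! c \<le> N) \<and>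
     (\<forall>r<k. \<forall>c<row_len D r. D ! r ! c = N) \<and>
     (\<forall>r s c. r < s \<and> s < k \<and> c \<le> row_len D s \<longrightarrow> D ! s ! c \<le> D ! r ! c)"

definition diagram_size :: "diagram \<Rightarrow> nat" where
  "diagram_size D = (\<Sum>r<length D. row_len D r)"

definition contained_in_rect :: "nat \<Rightarrow> nat \<Rightarrow> diagram \<Rightarrow> bool" where
  "contained_in_rect a b D \<longleftrightarrow> length D = b \<and> (\<forall>r<b. row_len D r \<le> a)"

definition rows_labeled :: "diagram \<Rightarrow> nat \<Rightarrow> nat set" where
  "rows_labeled D i = {r. r < length D \<and> row_label D r = i}"

definition label_sum :: "diagram \<Rightarrow> nat \<Rightarrow> nat" where
  "label_sum D i = (\<Sum>r\<in>rows_labeled D i. row_len D r)"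

definition cond1 :: "(nat \<Rightarrow> nat) \<Rightarrow> diagram \<Rightarrow> bool" where
  "cond1 lam D \<longleftrightarrow> (\<forall>i\<ge>1. card (rows_labeled D i) = conjugate lam i)"

definition cond2 :: "nat \<Rightarrow> (nat \<Rightarrow> nat) \<Rightarrow> diagram \<Rightarrow> bool" where
  "cond2 a lam D \<longleftrightarrow>
     (\<forall>j\<ge>1. lam (j + 1) < lam j \<longrightarrow>
        (\<forall>i. lam (j + 1) + 1 \<le> i \<and> i < lam j \<longrightarrow> label_sum D i \<le> label_sum D (i + 1)) \<and>
        int (label_sum D (lam j))
          \<le> int j * (int a + 1 + int (lam j) + int (lam (j + 1))) - 2 * int (partial_sum lam j))"

definition cond3 :: "(nat \<Rightarrow> nat) \<Rightarrow> diagram \<Rightarrow> bool" where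
  "cond3 lam D \<longleftrightarrow>
     (\<forall>j\<ge>1. \<forall>r<length D.
        lam (j + 1) + 1 \<le> row_label D r \<and> row_label D r \<le> lam j \<longrightarrow>
        int (lam j) + int (lam (j + 1)) - 1 \<le> int (row_len D r))"

definition cond4 :: "diagram \<Rightarrow> bool" where
  "cond4 D \<longleftrightarrow>
     (\<forall>i. rows_labeled D i \<noteq> {} \<longrightarrow>
        Max (row_len D ` rows_labeled D i) \<le> Min (row_len D ` rows_labeled D i) + 1)"

definition size_gen_fun :: "diagram set \<Rightarrow> rat fps" where
  "size_gen_fun S = Abs_fps (\<lambda>n. of_nat (card {D \<in> S. diagram_size D = n}))"

end

theory Submission
  imports Defs "HOL-Library.Product_Lexorder" "HOL-Library.FuncSet"
begin

text \<open>
  A modular diagram is determined by the multisets of row lengths carried by its labels, and by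
  condition (4) each of these is determined by its size \<open>\<lambda>'\<^sub>i\<close> and its sum
  \<open>\<Sigma>\<^sub>i\<close>.  The \<open>\<lambda>\<^sub>j - \<lambda>\<^sub>j\<^sub>+\<^sub>1\<close> labels
  \<open>i\<close> with \<open>\<lambda>'\<^sub>i = j\<close> thus contribute an arbitrary weakly increasing sequence of
  sums \<open>\<Sigma>\<^sub>i\<close> between \<open>j (\<lambda>\<^sub>j + \<lambda>\<^sub>j\<^sub>+\<^sub>1 - 1)\<close>, which is
  condition (3), and the upper bound of condition (2); that bound is at most \<open>j a\<close>, so the
  rectangle imposes no further restriction.  Such sequences are counted by a Gaussian polynomial
  times a power of \<open>q\<close>, and the exponents of these powers add up to
  \<open>2 \<Sum>\<^sub>i (\<lambda>\<^sub>i choose 2)\<close> by summation by parts.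
\<close>

subsection \<open>Gaussian polynomials and sorted lists\<close>

text \<open>Sorted lists stand for multisets of size \<open>m\<close>; the list form lets the entry
  belonging to a given label be read off by position.\<close>

definition sorted_lists :: "nat set \<Rightarrow> nat \<Rightarrow> nat list set" where
  "sorted_lists A m = {xs. length xs = m \<and> sorted xs \<and> set xs \<subseteq> A}"

lemma finite_sorted_lists: "finite A \<Longrightarrow> finite (sorted_lists A m)"
  by (rule finite_subset[OF _ finite_lists_length_eq[of A m]]) (auto simp: sorted_lists_def)

lemma sorted_lists_0: "sorted_lists A 0 = {[]}"
  by (auto simp: sorted_lists_def)

lemma sorted_lists_singleton: "sorted_lists {x} m = {replicate m x}"
proof -
  have "xs = replicate (length xs) x" if "set xs \<subseteq> {x}" for xs
    using that by (induction xs) auto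
  then show ?thesis
    by (auto simp: sorted_lists_def)
qed

text \<open>Split on whether the last entry, which is the largest, equals
  \<open>Suc n\<close>.\<close>

lemma sorted_lists_Suc:
  "sorted_lists {..Suc n} (Suc m) =
     sorted_lists {..n} (Suc m) \<union> (\<lambda>xs. xs @ [Suc n]) ` sorted_lists {..Suc n} m"
  (is "?L = ?R")
proof
  show "?L \<subseteq> ?R"
  proof
    fix xs assume xs: "xs \<in> ?L"
    then have "xs \<noteq> []" by (auto simp: sorted_lists_def)
    then obtain ys y where ys: "xs = ys @ [y]" by (metis rev_exhaust)
    show "xs \<in> ?R"
    proof (cases "y = Suc n")
      case True
      then show ?thesis using xs ys by (auto simp: sorted_lists_def sorted_append)
    next
      case False
      then have "set xs \<subseteq> {..n}"
        using xs ys by (fastforce simp: sorted_lists_def sorted_append)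
      then show ?thesis using xs by (auto simp: sorted_lists_def)
    qed
  qed
  show "?R \<subseteq> ?L"
    by (auto simp: sorted_lists_def sorted_append)
qed

definition sum_gf :: "nat list set \<Rightarrow> rat fps" where
  "sum_gf S = (\<Sum>xs\<in>S. fps_X ^ sum_list xs)"

text \<open>The q-Pascal recurrence: deleting a final entry \<open>Suc n\<close> takes out the
  factor \<open>fps_X ^ Suc n\<close>.\<close>

lemma sum_gf_Suc:
  "sum_gf (sorted_lists {..Suc n} (Suc m)) =
     sum_gf (sorted_lists {..n} (Suc m)) + fps_X ^ Suc n * sum_gf (sorted_lists {..Suc n} m)"
proof -
  have inj: "inj_on (\<lambda>xs. xs @ [Suc n]) S" for S
    by (auto simp: inj_on_def)
  have "sum_gf ((\<lambda>xs. xs @ [Suc n]) ` S) = fps_X ^ Suc n * sum_gf S" for S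
    by (simp add: sum_gf_def sum.reindex[OF inj] sum_distrib_left power_add mult_ac)
  moreover have "sum_gf (sorted_lists {..Suc n} (Suc m)) = sum_gf (sorted_lists {..n} (Suc m)) +
      sum_gf ((\<lambda>xs. xs @ [Suc n]) ` sorted_lists {..Suc n} m)"
    unfolding sorted_lists_Suc sum_gf_def
    by (rule sum.union_disjoint) (auto simp: finite_sorted_lists, auto simp: sorted_lists_def)
  ultimately show ?thesis by simp
qed

lemma q_poch_0 [simp]: "q_poch 0 = 1"
  by (simp add: q_poch_def)

lemma q_poch_Suc: "q_poch (Suc n) = (1 - fps_X ^ Suc n) * q_poch n"
  by (simp add: q_poch_def mult.commute)

text \<open>Each factor has constant coefficient 1. This allows the denominators of
  \<open>gauss_poly\<close> to be cancelled.\<close>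

lemma q_poch_nonzero: "q_poch n \<noteq> 0"
proof -
  have "fps_nth (1 - fps_X ^ Suc k :: rat fps) 0 \<noteq> 0" for k
    by simp
  then have "(1 - fps_X ^ Suc k :: rat fps) \<noteq> 0" for k
    by (metis fps_zero_nth)
  then show ?thesis by (induction n) (simp_all add: q_poch_Suc del: power_Suc)
qed

text \<open>The product formula with denominators cleared. The induction is on \<open>n + m\<close>
  because the recurrence lowers \<open>n\<close> in one term and \<open>m\<close> in the
  other.\<close>

lemma q_poch_sum_gf:
  "q_poch m * q_poch n * sum_gf (sorted_lists {..n} m) = q_poch (n + m)"
proof (induction "n + m" arbitrary: n m)
  case 0
  then show ?case by (simp add: sorted_lists_0 sum_gf_def)
next
  case (Suc k)
  show ?case
  proof (cases "n = 0 \<or> m = 0")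
    case True
    then show ?thesis
      by (auto simp: sorted_lists_0 sum_gf_def sorted_lists_singleton sum_list_replicate)
  next
    case False
    then obtain n' m' where nm: "n = Suc n'" "m = Suc m'"
      by (meson not0_implies_Suc)
    have 1: "q_poch m * q_poch n' * sum_gf (sorted_lists {..n'} m) = q_poch k"
      using Suc.hyps(1)[of n' m] Suc.hyps(2) nm by simp
    have 2: "q_poch m' * q_poch n * sum_gf (sorted_lists {..n} m') = q_poch k"
      using Suc.hyps(1)[of n m'] Suc.hyps(2) nm by simp
    have "q_poch m * q_poch n * sum_gf (sorted_lists {..n} m) =
      (1 - fps_X ^ n) * (q_poch m * q_poch n' * sum_gf (sorted_lists {..n'} m)) +
      fps_X ^ n * (1 - fps_X ^ m) * (q_poch m' * q_poch n * sum_gf (sorted_lists {..n} m'))"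
      unfolding nm sum_gf_Suc by (simp only: q_poch_Suc) algebra
    \<comment> \<open>With q for \<open>fps_X\<close>: (1 - q^n) + q^n (1 - q^m) = 1 -
      q^(n+m).\<close>
    also have "\<dots> = (1 - fps_X ^ (n + m)) * q_poch k"
      unfolding 1 2 by (simp add: algebra_simps power_add)
    also have "\<dots> = q_poch (n + m)"
      using Suc.hyps(2)[symmetric] by (simp only: q_poch_Suc)
    finally show ?thesis .
  qed
qed

lemma sum_gf_gauss_poly: "sum_gf (sorted_lists {..n} m) = gauss_poly (int (n + m)) m"
proof (cases "m = 0")
  case True
  then show ?thesis by (simp add: sorted_lists_0 sum_gf_def gauss_poly_def)
next
  case False
  have "nat (int (n + m)) = n + m" by simp
  with False show ?thesis
    by (simp add: gauss_poly_def q_poch_sum_gf[of m n, symmetric] q_poch_nonzero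
        del: of_nat_add)
qed

text \<open>Subtracting \<open>u\<close> from all \<open>m\<close> entries moves the interval to
  \<open>{..v - u}\<close> and takes out \<open>fps_X ^ (m * u)\<close>. The bound \<open>v\<close>
  is an integer because the bounds of condition (2) can be negative.\<close>

lemma sum_gf_interval:
  "sum_gf (sorted_lists {x. u \<le> x \<and> int x \<le> v} m) =
     fps_X ^ (m * u) * gauss_poly (v - int u + int m) m"
proof (cases "m = 0")
  case True
  then show ?thesis by (simp add: sorted_lists_0 sum_gf_def gauss_poly_def)
next
  case m: False
  show ?thesis
  proof (cases "int u \<le> v")
    case False
    \<comment> \<open>The interval is empty exactly when the top entry \<open>v - u + m\<close> is
      below \<open>m\<close>, where \<open>gauss_poly\<close> is 0 by convention.\<close>
    then have empty: "{x. u \<le> x \<and> int x \<le> v} = {}" by auto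
    have "sorted_lists {x. u \<le> x \<and> int x \<le> v} m = {}"
      using m unfolding empty by (auto simp: sorted_lists_def)
    with m False show ?thesis by (simp add: sum_gf_def gauss_poly_def)
  next
    case True
    define n where "n = nat (v - int u)"
    have v: "v = int (u + n)" using True by (simp add: n_def)
    have set: "sorted_lists {x. u \<le> x \<and> int x \<le> v} m = map ((+) u) ` sorted_lists {..n} m"
    proof (intro equalityI subsetI)
      fix xs assume xs: "xs \<in> sorted_lists {x. u \<le> x \<and> int x \<le> v} m"
      have le: "\<forall>x\<in>set xs. u \<le> x \<and> x \<le> u + n"
        using xs v by (auto simp: sorted_lists_def)
      then have "xs = map ((+) u) (map (\<lambda>x. x - u) xs)"
        by (auto simp: o_def intro!: map_idI[symmetric])
      moreover have "sorted (map (\<lambda>x. x - u) xs)"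
        using xs by (auto simp: sorted_lists_def sorted_map intro: sorted_wrt_mono_rel[rotated])
      then have "map (\<lambda>x. x - u) xs \<in> sorted_lists {..n} m"
        using xs le by (auto simp: sorted_lists_def)
      ultimately show "xs \<in> map ((+) u) ` sorted_lists {..n} m" by blast
    next
      fix xs assume "xs \<in> map ((+) u) ` sorted_lists {..n} m"
      then show "xs \<in> sorted_lists {x. u \<le> x \<and> int x \<le> v} m"
        by (auto simp: v sorted_lists_def sorted_map subset_iff)
    qed
    have inj: "inj_on (map ((+) u)) S" for S
      by (auto simp: inj_on_def)
    have "sum_list (map ((+) u) xs) = length xs * u + sum_list xs" for xs
      by (induction xs) auto
    then have "sum_gf (map ((+) u) ` sorted_lists {..n} m) =
        fps_X ^ (m * u) * sum_gf (sorted_lists {..n} m)"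
      unfolding sum_gf_def sum.reindex[OF inj] sum_distrib_left
      by (intro sum.cong) (simp_all add: sorted_lists_def power_add)
    then show ?thesis
      unfolding set by (simp add: sum_gf_gauss_poly v)
  qed
qed

subsection \<open>Modular diagrams as families of multisets\<close>

definition len_mset :: "diagram \<Rightarrow> nat \<Rightarrow> nat multiset" where
  "len_mset D i = image_mset (row_len D) (mset_set (rows_labeled D i))"

lemma finite_rows_labeled [simp]: "finite (rows_labeled D i)"
  by (simp add: rows_labeled_def)

lemma size_len_mset: "size (len_mset D i) = card (rows_labeled D i)"
  by (simp add: len_mset_def)

lemma sum_mset_len_mset: "sum_mset (len_mset D i) = label_sum D i"
  by (simp add: len_mset_def label_sum_def sum_unfold_sum_mset)

lemma set_mset_len_mset: "set_mset (len_mset D i) = row_len D ` rows_labeled D i"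
  by (simp add: len_mset_def)

text \<open>A row of a modular diagram is determined by its length and its label, since all other
  cells carry \<open>N\<close>; \<open>row_of N\<close> rebuilds it.\<close>

definition row_pair :: "nat list \<Rightarrow> nat \<times> nat" where
  "row_pair r = (length r - 1, last r)"

definition row_of :: "nat \<Rightarrow> nat \<times> nat \<Rightarrow> nat list" where
  "row_of N p = replicate (fst p) N @ [snd p]"

lemma row_pair_row_of [simp]: "row_pair (row_of N p) = p"
  by (simp add: row_pair_def row_of_def)

lemma len_mset_conv_row_pair:
  "len_mset D i = image_mset fst (filter_mset (\<lambda>p. snd p = i) (mset (map row_pair D)))"
proof -
  have "mset (map row_pair D) = image_mset (\<lambda>r. row_pair (D ! r)) (mset_set {..<length D})"
  proof -
    have "mset (map row_pair D) = mset (map row_pair (map ((!) D) [0..<length D]))"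
      by (simp only: map_nth)
    then show ?thesis
      by (simp only: mset_map mset_upt multiset.map_comp o_def atLeast0LessThan)
  qed
  then have "image_mset fst (filter_mset (\<lambda>p. snd p = i) (mset (map row_pair D))) =
      image_mset (\<lambda>r. fst (row_pair (D ! r)))
        (mset_set {r \<in> {..<length D}. snd (row_pair (D ! r)) = i})"
    by (simp add: filter_mset_image_mset filter_mset_mset_set image_mset.compositionality o_def)
  then show ?thesis
    by (simp add: len_mset_def rows_labeled_def row_pair_def row_len_def[abs_def] row_label_def)
qed

text \<open>The family \<open>len_mset D\<close> and the multiset of pairs (length, label) carry the
  same information.\<close>

lemma count_row_pair:
  "count (mset (map row_pair D)) (l, i) = count (len_mset D i) l"
proof -
  have "count (image_mset fst (filter_mset (\<lambda>p. snd p = i) M)) l = count M (l, i)"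
    for M :: "(nat \<times> nat) multiset"
    by (induction M) (auto simp: prod_eq_iff)
  then show ?thesis by (simp only: len_mset_conv_row_pair)
qed

text \<open>
  The column condition orders rows of equal length by weakly decreasing label and says nothing
  about rows of different lengths, so the pairs (length, label) decrease lexicographically.
\<close>

lemma modular_diagram_conv:
  "modular_diagram N k D \<longleftrightarrow>
     (\<exists>ps. length ps = k \<and> sorted (rev ps) \<and> (\<forall>p\<in>set ps. 1 \<le> snd p \<and> snd p \<le> N) \<and>
           D = map (row_of N) ps)"
  (is "?L \<longleftrightarrow> ?R")
proof
  assume D: ?L
  then have len: "length D = k" by (simp add: modular_diagram_def)
  have row: "D ! r = row_of N (row_pair (D ! r))" if "r < k" for r
  proof -
    have ne: "D ! r \<noteq> []" using D that by (simp add: modular_diagram_def)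
    have "\<forall>c<row_len D r. D ! r ! c = N" using D that by (simp add: modular_diagram_def)
    then have "butlast (D ! r) = replicate (row_len D r) N"
      by (intro nth_equalityI) (auto simp: row_len_def nth_butlast)
    then show ?thesis
      using append_butlast_last_id[OF ne] by (simp add: row_of_def row_pair_def row_len_def)
  qed
  have lab: "last (D ! r) = D ! r ! row_len D r" if "r < k" for r
    using D that by (simp add: modular_diagram_def row_len_def last_conv_nth)
  have "row_pair (D ! s) \<le> row_pair (D ! r)" if "r < s" "s < k" for r s
  proof -
    \<comment> \<open>The last cell of row \<open>s\<close> is compared with the cell of row
      \<open>r\<close> in the same column. For equal lengths that cell is also the last one of row
      \<open>r\<close>, so the labels are compared.\<close>
    have "row_len D s \<le> row_len D r" "D ! s ! row_len D s \<le> D ! r ! row_len D s"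
      using D that by (simp_all add: modular_diagram_def)
    then show ?thesis
      using lab[of r] lab[of s] that
      by (cases "row_len D s = row_len D r") (auto simp: row_pair_def row_len_def less_eq_prod_def)
  qed
  then have "sorted (rev (map row_pair D))"
    unfolding sorted_wrt_rev using len by (auto simp: sorted_wrt_iff_nth_less)
  moreover have "\<forall>p\<in>set (map row_pair D). 1 \<le> snd p \<and> snd p \<le> N"
    using D lab len by (auto simp: modular_diagram_def row_pair_def in_set_conv_nth)
  moreover have "D = map (row_of N) (map row_pair D)"
    using row len by (auto intro!: nth_equalityI)
  ultimately show ?R using len by (metis length_map)
next
  assume ?R
  then obtain ps where ps: "length ps = k" "sorted (rev ps)"
      "\<forall>p\<in>set ps. 1 \<le> snd p \<and> snd p \<le> N" and D: "D = map (row_of N) ps"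
    by blast
  have le: "ps ! s \<le> ps ! r" if "r < s" "s < k" for r s
    using ps that unfolding sorted_wrt_rev by (auto simp: sorted_wrt_iff_nth_less)
  have snd: "1 \<le> snd (ps ! r)" "snd (ps ! r) \<le> N" if "r < k" for r
    using ps that by auto
  have len: "row_len D r = fst (ps ! r)" if "r < k" for r
    using that ps by (simp add: D row_len_def row_of_def)
  have cell: "D ! r ! c = (if c < fst (ps ! r) then N else snd (ps ! r))"
    if "r < k" "c \<le> fst (ps ! r)" for r c
    using that ps by (auto simp: D row_of_def nth_append)
  \<comment> \<open>If row \<open>r\<close> continues beyond column \<open>c\<close>, its cell there
    is \<open>N\<close>, the largest label. Otherwise both rows end at \<open>c\<close> and the
    lexicographic order compares their labels.\<close>
  have "D ! s ! c \<le> D ! r ! c" if "r < s" "s < k" "c \<le> row_len D s" for r s c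
    using le[OF that(1,2)] that len[of s] snd[of r] snd[of s] cell[of r c] cell[of s c]
    by (auto simp: less_eq_prod_def split: if_splits)
  moreover have "row_len D s \<le> row_len D r" if "r < s" "s < k" for r s
    using le[OF that] that by (auto simp: len less_eq_prod_def)
  moreover have "1 \<le> D ! r ! c \<and> D ! r ! c \<le> N" if "r < k" "c \<le> row_len D r" for r c
    using cell[of r c] snd[OF that(1)] that len[of r] by (auto split: if_splits)
  moreover have "D ! r ! c = N" if "r < k" "c < row_len D r" for r c
    using cell[of r c] that len[of r] by simp
  moreover have "length D = k" "\<forall>r<k. D ! r \<noteq> []"
    using ps(1) by (simp_all add: D row_of_def)
  ultimately show ?L
    unfolding modular_diagram_def by blast
qed

text \<open>The length multisets fix the multiset of pairs (length, label), and a sorted list is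
  determined by its multiset.\<close>

lemma modular_diagram_eqI:
  assumes "modular_diagram N k D" "modular_diagram N k' D'"
    and "\<And>i. len_mset D i = len_mset D' i"
  shows "D = D'"
proof -
  obtain ps ps' where ps: "sorted (rev ps)" "D = map (row_of N) ps"
      and ps': "sorted (rev ps')" "D' = map (row_of N) ps'"
    using assms(1,2) unfolding modular_diagram_conv by blast
  have "count (mset (map row_pair D)) p = count (mset (map row_pair D')) p" for p
    using assms(3) by (cases p) (simp only: count_row_pair)
  then have "mset (map row_pair D) = mset (map row_pair D')"
    by (rule multiset_eqI)
  moreover have "map row_pair D = ps" "map row_pair D' = ps'"
    by (simp_all add: ps ps' o_def)
  ultimately have "mset (rev ps) = mset (rev ps')"
    by simp
  then have "rev ps = rev ps'"
    using ps(1) ps'(1) by (metis properties_for_sort)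
  then show ?thesis using ps ps' by simp
qed

lemma modular_diagram_label:
  assumes "modular_diagram N k D" "r < k"
  shows "1 \<le> row_label D r" "row_label D r \<le> N"
  using assms by (auto simp: modular_diagram_def row_label_def row_len_def last_conv_nth)

text \<open>Tag every length with its label, sort the pairs decreasingly and draw the rows. Only the
  labels \<open>1..N\<close> are collected, so all other \<open>A i\<close> must be empty.\<close>

lemma modular_diagram_exists:
  assumes "\<And>i. i \<notin> {1..N} \<Longrightarrow> A i = {#}"
  obtains D where "modular_diagram N (\<Sum>i = 1..N. size (A i)) D" "\<And>i. len_mset D i = A i"
proof -
  define M where "M = (\<Sum>i = 1..N. image_mset (\<lambda>l. (l, i)) (A i))"
  define ps where "ps = rev (sorted_list_of_multiset M)"
  define D where "D = map (row_of N) ps"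
  have mset: "mset ps = M" by (simp add: ps_def)
  have "length ps = size M" by (metis mset size_mset)
  also have "\<dots> = (\<Sum>i = 1..N. size (A i))" by (simp add: M_def size_multiset_sum)
  finally have "modular_diagram N (\<Sum>i = 1..N. size (A i)) D"
    unfolding modular_diagram_conv
  proof (intro exI conjI)
    show "sorted (rev ps)" by (simp add: ps_def)
    have "set ps = set_mset M" by (metis mset set_mset_mset)
    also have "\<dots> = (\<Union>i\<in>{1..N}. (\<lambda>l. (l, i)) ` set_mset (A i))"
      by (simp add: M_def set_mset_sum)
    finally show "\<forall>p\<in>set ps. 1 \<le> snd p \<and> snd p \<le> N" by auto
  qed (simp_all add: D_def)
  moreover have "len_mset D i = A i" for i
  proof (rule multiset_eqI)
    fix l
    have *: "count (image_mset (\<lambda>l. (l, i')) B) (l, i) = (if i' = i then count B l else 0)"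
      for i' and B :: "nat multiset"
      by (induction B) auto
    have "map row_pair D = ps" by (simp add: D_def o_def)
    then have "count (len_mset D i) l = count M (l, i)"
      by (metis count_row_pair mset)
    also have "\<dots> = (\<Sum>i' = 1..N. if i' = i then count (A i') l else 0)"
      by (simp add: M_def count_sum *)
    also have "\<dots> = count (A i) l"
      using assms[of i] by (simp add: sum.delta)
    finally show "count (len_mset D i) l = count (A i) l" .
  qed
  ultimately show thesis using that by blast
qed

subsection \<open>Balanced multisets\<close>

text \<open>The \<open>k\<close> parts of sum \<open>s\<close> that are as equal as possible: the
  remainder \<open>s mod k\<close> counts the parts exceeding the quotient by one.\<close>

definition balanced :: "nat \<Rightarrow> nat \<Rightarrow> nat multiset" where
  "balanced k s = replicate_mset (k - s mod k) (s div k) + replicate_mset (s mod k) (s div k + 1)"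

lemma size_balanced: "0 < k \<Longrightarrow> size (balanced k s) = k"
  by (simp add: balanced_def less_imp_le)

lemma sum_mset_balanced:
  assumes "0 < k"
  shows "sum_mset (balanced k s) = s"
proof -
  have "sum_mset (balanced k s) = (k - s mod k) * (s div k) + s mod k * (s div k + 1)"
    by (simp add: balanced_def sum_mset_replicate_mset)
  also have "\<dots> = ((k - s mod k) + s mod k) * (s div k) + s mod k"
    by (simp only: add_mult_distrib add_mult_distrib2 mult_1_right add.assoc)
  also have "\<dots> = s" using assms by (simp add: less_imp_le)
  finally show ?thesis .
qed

lemma balanced_mem:
  "x \<in># balanced k s \<Longrightarrow> x = s div k \<or> x = s div k + 1 \<and> s mod k \<noteq> 0"
  by (auto simp: balanced_def split: if_splits)

text \<open>The larger part is a danger only if the quotient is already \<open>a\<close>; then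
  \<open>s = k * a\<close> and the remainder vanishes.\<close>

lemma balanced_le:
  assumes "x \<in># balanced k s" "0 < k" "s \<le> k * a"
  shows "x \<le> a"
proof -
  have le: "s div k \<le> a" using div_le_mono[OF assms(3), of k] assms(2) by simp
  have "s = k * (s div k) + s mod k" by simp
  then have "s mod k = 0" if "s div k = a" using assms(3) that by simp
  with le show ?thesis using balanced_mem[OF assms(1)] by fastforce
qed

lemma balanced_ge:
  assumes "x \<in># balanced k s" "0 < k" "k * c \<le> s"
  shows "c \<le> x"
  using div_le_mono[OF assms(3), of k] balanced_mem[OF assms(1)] assms(2) by auto

text \<open>All entries are \<open>m\<close> or \<open>m + 1\<close>, where \<open>m\<close> is the
  minimum, so \<open>m\<close> and the number \<open>d\<close> of larger entries must be quotient
  and remainder of the sum by the size.\<close>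

lemma balanced_unique:
  assumes "A \<noteq> {#}" and diff: "\<And>x y. x \<in># A \<Longrightarrow> y \<in># A \<Longrightarrow> x \<le> y + 1"
  shows "A = balanced (size A) (sum_mset A)"
proof -
  define m where "m = Min (set_mset A)"
  define d where "d = count A (m + 1)"
  have m: "m \<in># A" using assms(1) by (simp add: m_def)
  have set: "x = m \<or> x = m + 1" if "x \<in># A" for x
    using diff[OF that m] Min_le[OF finite_set_mset that, folded m_def] by linarith
  have A: "A = replicate_mset (count A m) m + replicate_mset d (m + 1)"
    using set by (intro multiset_eqI) (auto simp: d_def simp flip: not_in_iff)
  have size: "size A = count A m + d" by (subst A) simp
  have "sum_mset A = count A m * m + d * (m + 1)" by (subst A) simp
  then have sum: "sum_mset A = size A * m + d" by (simp add: size algebra_simps)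
  \<comment> \<open>Strict because the minimum itself occurs; hence \<open>d\<close> is a genuine
    remainder.\<close>
  have "d < size A" using size m by simp
  then have "sum_mset A div size A = m" "sum_mset A mod size A = d"
    using assms(1) by (simp_all add: sum)
  then show ?thesis using A size by (simp add: balanced_def)
qed

subsection \<open>Blocks of labels\<close>

text \<open>Summation by parts. It is applied to functions vanishing at \<open>l + 1\<close>, where
  the boundary term disappears.\<close>

lemma sum_weighted_differences:
  fixes f :: "nat \<Rightarrow> int"
  shows "(\<Sum>j = 1..l. int j * (f j - f (j + 1))) = (\<Sum>j = 1..l. f j) - int l * f (l + 1)"
  by (induction l) (auto simp: algebra_simps)

text \<open>Turns the cardinality defining \<open>conjugate\<close> into the endpoint of an initial
  segment.\<close>

lemma initial_segment_eq:
  fixes J :: "nat set"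
  assumes "finite J" "\<And>j. j \<in> J \<Longrightarrow> 1 \<le> j" "\<And>i j. j \<in> J \<Longrightarrow> 1 \<le> i \<Longrightarrow> i \<le> j \<Longrightarrow> i \<in> J"
  shows "J = {1..card J}"
proof (cases "J = {}")
  case False
  then have "Max J \<in> J" using assms(1) by simp
  then have "j \<in> J \<longleftrightarrow> j \<in> {1..Max J}" for j
    using Max_ge[OF assms(1)] assms(2,3) by (meson atLeastAtMost_iff)
  then have "J = {1..Max J}" by blast
  then show ?thesis by (metis card_atLeastAtMost diff_Suc_1)
qed simp

text \<open>
  Block \<open>j\<close> consists of the labels \<open>i\<close> with \<open>lam (j + 1) < i \<le> lam j\<close>.  The truncated
  subtraction in the lower bound is harmless, since \<open>lam j > 0\<close> whenever the block is nonempty.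
\<close>

definition block_lower :: "(nat \<Rightarrow> nat) \<Rightarrow> nat \<Rightarrow> nat" where
  "block_lower lam j = j * (lam j + lam (j + 1) - 1)"

text \<open>Integer-valued, since it can be negative: for parts 10 and 1, \<open>a = 1\<close> and
  \<open>j = 2\<close> it is -16.\<close>

definition block_upper :: "nat \<Rightarrow> (nat \<Rightarrow> nat) \<Rightarrow> nat \<Rightarrow> int" where
  "block_upper a lam j =
     int j * (int a + 1 + int (lam j) + int (lam (j + 1))) - 2 * int (partial_sum lam j)"

definition block_lists :: "nat \<Rightarrow> (nat \<Rightarrow> nat) \<Rightarrow> nat \<Rightarrow> nat list set" where
  "block_lists a lam j =
     sorted_lists {x. block_lower lam j \<le> x \<and> int x \<le> block_upper a lam j}
       (lam j - lam (j + 1))"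

definition block_sums :: "(nat \<Rightarrow> nat) \<Rightarrow> diagram \<Rightarrow> nat \<Rightarrow> nat list" where
  "block_sums lam D j = map (label_sum D) [lam (j + 1) + 1..<lam j + 1]"

section \<open>The conjugate partition and the grouping of labels into blocks\<close>

context
  fixes lam :: "nat \<Rightarrow> nat"
  assumes part: "is_partition lam"
begin

lemma partition_antimono:
  assumes "1 \<le> i" "i \<le> j"
  shows "lam j \<le> lam i"
  using assms(2)
proof (induction j rule: dec_induct)
  case (step j)
  then have "lam (j + 1) \<le> lam j" using part assms(1) by (simp add: is_partition_def)
  with step show ?case by simp
qed simp

text \<open>As \<open>lam\<close> decreases, the indices \<open>j\<close> with
  \<open>i \<le> lam j\<close> form an initial segment, whose length is
  \<open>conjugate lam i\<close>.\<close>

lemma le_conjugate_iff: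
  assumes "1 \<le> i" "1 \<le> j"
  shows "j \<le> conjugate lam i \<longleftrightarrow> i \<le> lam j"
proof -
  let ?J = "{j. 1 \<le> j \<and> i \<le> lam j}"
  have "finite {j. 1 \<le> j \<and> lam j \<noteq> 0}" using part by (simp add: is_partition_def)
  then have "finite ?J" by (rule rev_finite_subset) (use assms in auto)
  then have "?J = {1..conjugate lam i}"
    unfolding conjugate_def
    by (rule initial_segment_eq) (auto intro: le_trans[OF _ partition_antimono])
  then have "j \<in> ?J \<longleftrightarrow> j \<in> {1..conjugate lam i}" by (rule arg_cong)
  then show ?thesis using assms by simp
qed

lemma le_num_parts_iff:
  assumes "1 \<le> j"
  shows "j \<le> num_parts lam \<longleftrightarrow> lam j \<noteq> 0"
proof -
  have "num_parts lam = conjugate lam 1"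
    by (simp add: num_parts_def conjugate_def Suc_le_eq)
  then show ?thesis using le_conjugate_iff[OF _ assms, of 1] by auto
qed

text \<open>Block \<open>j\<close> is a fibre of \<open>conjugate lam\<close>, so the block of a
  label can be recovered from the label.\<close>

lemma conjugate_eq:
  assumes "1 \<le> j" "lam (j + 1) < i" "i \<le> lam j"
  shows "conjugate lam i = j"
  using le_conjugate_iff[of i j] le_conjugate_iff[of i "j + 1"] assms by simp

lemma conjugate_block:
  assumes "1 \<le> i" "i \<le> lam 1"
  shows "1 \<le> conjugate lam i" "conjugate lam i \<le> num_parts lam"
    "lam (conjugate lam i + 1) < i" "i \<le> lam (conjugate lam i)"
proof -
  let ?j = "conjugate lam i"
  show 1: "1 \<le> ?j" using le_conjugate_iff[of i 1] assms by simp
  show 2: "i \<le> lam ?j" using le_conjugate_iff[of i ?j] 1 assms by simp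
  show "lam (?j + 1) < i" using le_conjugate_iff[of i "?j + 1"] assms by simp
  show "?j \<le> num_parts lam" using le_num_parts_iff[OF 1] 2 assms by simp
qed

lemma block_range:
  assumes "1 \<le> j" "lam (j + 1) < i" "i \<le> lam j"
  shows "1 \<le> i" "i \<le> lam 1" "j \<le> num_parts lam"
  using assms partition_antimono[of 1 j] le_num_parts_iff[of j] by auto

text \<open>The blocks partition the labels: group by the value of
  \<open>conjugate lam\<close>.\<close>

lemma sum_blocks:
  fixes f :: "nat \<Rightarrow> nat"
  shows "(\<Sum>i = 1..lam 1. f i) = (\<Sum>j = 1..num_parts lam. \<Sum>i = lam (j + 1) + 1..lam j. f i)"
proof -
  have "(\<Sum>i = 1..lam 1. f i) =
      (\<Sum>j = 1..num_parts lam. sum f {i \<in> {1..lam 1}. conjugate lam i = j})"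
    using conjugate_block by (intro sum.group[symmetric]) auto
  also have "\<dots> = (\<Sum>j = 1..num_parts lam. \<Sum>i = lam (j + 1) + 1..lam j. f i)"
  proof (rule sum.cong)
    fix j assume "j \<in> {1..num_parts lam}"
    then have "i \<in> {1..lam 1} \<and> conjugate lam i = j \<longleftrightarrow> i \<in> {lam (j + 1) + 1..lam j}" for i
      using conjugate_block[of i] conjugate_eq[of j i] block_range[of j i] by auto
    then have "{i \<in> {1..lam 1}. conjugate lam i = j} = {lam (j + 1) + 1..lam j}"
      by blast
    then show "sum f {i \<in> {1..lam 1}. conjugate lam i = j} = (\<Sum>i = lam (j + 1) + 1..lam j. f i)"
      by simp
  qed simp
  finally show ?thesis .
qed

lemma partition_num_parts_Suc: "lam (num_parts lam + 1) = 0"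
  using le_num_parts_iff[of "num_parts lam + 1"] by simp

lemma partition_Suc_le: "1 \<le> j \<Longrightarrow> lam (j + 1) \<le> lam j"
  by (rule partition_antimono) simp_all

text \<open>Label \<open>i\<close> will get \<open>conjugate lam i\<close> rows, so this yields the
  total number of rows. Block \<open>j\<close> contributes \<open>j * (lam j - lam (j + 1))\<close>,
  and summation by parts finishes.\<close>

lemma sum_conjugate: "(\<Sum>i = 1..lam 1. conjugate lam i) = partial_sum lam (num_parts lam)"
proof -
  have "(\<Sum>i = 1..lam 1. conjugate lam i) = (\<Sum>j = 1..num_parts lam. j * (lam j - lam (j + 1)))"
    unfolding sum_blocks
  proof (rule sum.cong)
    fix j assume "j \<in> {1..num_parts lam}"
    then have "(\<Sum>i = lam (j + 1) + 1..lam j. conjugate lam i) = (\<Sum>i = lam (j + 1) + 1..lam j. j)"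
      by (intro sum.cong) (auto intro!: conjugate_eq)
    then show "(\<Sum>i = lam (j + 1) + 1..lam j. conjugate lam i) = j * (lam j - lam (j + 1))"
      by simp
  qed simp
  also have "int \<dots> = (\<Sum>j = 1..num_parts lam. int j * (int (lam j) - int (lam (j + 1))))"
    unfolding of_nat_sum using partition_Suc_le by (intro sum.cong) (auto simp: of_nat_diff)
  also have "\<dots> = int (partial_sum lam (num_parts lam))"
    unfolding sum_weighted_differences[of "\<lambda>j. int (lam j)"] partition_num_parts_Suc
    by (simp add: partial_sum_def)
  finally show ?thesis by (simp only: of_nat_eq_iff)
qed

section \<open>Bounds and generating functions of the blocks\<close>

lemma int_block_lower:
  assumes "1 \<le> j" "j \<le> num_parts lam"
  shows "int (block_lower lam j) = int j * (int (lam j) + int (lam (j + 1)) - 1)"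
proof -
  have "lam j \<noteq> 0" using assms le_num_parts_iff by auto
  then have "int (lam j + lam (j + 1) - 1) = int (lam j) + int (lam (j + 1)) - 1"
    by linarith
  then show ?thesis by (simp only: block_lower_def of_nat_mult)
qed

text \<open>Since (x - y)(x + y - 1) = x(x - 1) - y(y - 1), each term is \<open>j\<close> times a
  difference of values of \<open>g\<close>, which is twice a binomial coefficient; then sum by
  parts.\<close>

lemma sum_block_lower:
  "(\<Sum>j = 1..num_parts lam. (lam j - lam (j + 1)) * block_lower lam j) =
     2 * (\<Sum>i = 1..num_parts lam. lam i choose 2)"
proof -
  define g where "g j = int (lam j) * (int (lam j) - 1)" for j
  have choose: "2 * int (n choose 2) = int n * (int n - 1)" for n
  proof -
    have "even (n * (n - 1))" by (cases n) auto
    then have "2 * (n choose 2) = n * (n - 1)"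
      by (simp only: choose_two dvd_mult_div_cancel)
    then have "2 * int (n choose 2) = int (n * (n - 1))" by linarith
    then show ?thesis by (cases n) (simp_all add: algebra_simps)
  qed
  have "int ((lam j - lam (j + 1)) * block_lower lam j) = int j * (g j - g (j + 1))"
    if "j \<in> {1..num_parts lam}" for j
  proof -
    have "int ((lam j - lam (j + 1)) * block_lower lam j) =
        (int (lam j) - int (lam (j + 1))) * (int j * (int (lam j) + int (lam (j + 1)) - 1))"
      using partition_Suc_le[of j] int_block_lower[of j] that by (simp add: of_nat_diff)
    also have "\<dots> = int j * (g j - g (j + 1))"
      unfolding g_def by (simp only: algebra_simps)
    finally show ?thesis .
  qed
  then have "int (\<Sum>j = 1..num_parts lam. (lam j - lam (j + 1)) * block_lower lam j) =
      (\<Sum>j = 1..num_parts lam. int j * (g j - g (j + 1)))"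
    unfolding of_nat_sum by (intro sum.cong refl)
  also have "\<dots> = (\<Sum>j = 1..num_parts lam. 2 * int (lam j choose 2))"
    unfolding sum_weighted_differences by (simp add: choose g_def partition_num_parts_Suc[simplified])
  also have "\<dots> = int (2 * (\<Sum>i = 1..num_parts lam. lam i choose 2))"
    by (simp add: sum_distrib_left)
  finally show ?thesis by linarith
qed

text \<open>Combines \<open>j * lam j \<le> partial_sum lam j\<close> with
  \<open>lam (j + 1) + 1 \<le> lam j\<close>. This is what keeps the rows inside the
  rectangle.\<close>

lemma block_upper_le:
  assumes "1 \<le> j" "lam (j + 1) < lam j"
  shows "block_upper a lam j \<le> int (j * a)"
proof -
  have "(\<Sum>i = 1..j. lam j) \<le> partial_sum lam j"
    unfolding partial_sum_def by (rule sum_mono) (auto intro: partition_antimono)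
  then have 1: "int j * int (lam j) \<le> int (partial_sum lam j)"
    by (simp flip: of_nat_mult)
  have "int j * (1 + int (lam (j + 1))) \<le> int j * int (lam j)"
    using assms by (intro mult_left_mono) auto
  with 1 show ?thesis by (simp add: block_upper_def algebra_simps)
qed

text \<open>The top entry comes from writing Y for partial sums: 2 Y_j - \<open>lam j\<close> +
  \<open>lam (j + 1)\<close> = Y_(j-1) + Y_(j+1).\<close>

lemma sum_gf_block_lists:
  assumes "1 \<le> j" "j \<le> num_parts lam"
  shows "sum_gf (block_lists a lam j) =
    fps_X ^ ((lam j - lam (j + 1)) * block_lower lam j) *
    gauss_poly (int j * (int a + 2) - int (partial_sum lam (j - 1)) - int (partial_sum lam (j + 1)))
      (lam j - lam (j + 1))"
proof -
  obtain k where k: "j = Suc k" using assms(1) by (cases j) auto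
  have "block_upper a lam j - int (block_lower lam j) + int (lam j - lam (j + 1)) =
      int j * (int a + 2) - int (partial_sum lam (j - 1)) - int (partial_sum lam (j + 1))"
    unfolding int_block_lower[OF assms] of_nat_diff[OF partition_Suc_le[OF assms(1)]]
    by (simp add: block_upper_def k partial_sum_def algebra_simps)
  then show ?thesis
    by (simp add: block_lists_def sum_gf_interval)
qed

end

subsection \<open>Diagrams and their label sums\<close>

definition admissible :: "nat \<Rightarrow> nat \<Rightarrow> (nat \<Rightarrow> nat) \<Rightarrow> diagram set" where
  "admissible a b lam =
     {D. modular_diagram (lam 1) b D \<and> contained_in_rect a b D \<and>
         cond1 lam D \<and> cond2 a lam D \<and> cond3 lam D \<and> cond4 D}"

text \<open>The pairwise form covers absent labels without mentioning extrema of an empty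
  set.\<close>

lemma cond4_iff:
  "cond4 D \<longleftrightarrow> (\<forall>i. \<forall>x\<in>#len_mset D i. \<forall>y\<in>#len_mset D i. x \<le> y + 1)"
proof -
  have *: "Max A \<le> Min A + 1 \<longleftrightarrow> (\<forall>x\<in>A. \<forall>y\<in>A. x \<le> y + 1)"
    if "finite A" "A \<noteq> {}" for A :: "nat set"
  proof
    assume "Max A \<le> Min A + 1"
    then show "\<forall>x\<in>A. \<forall>y\<in>A. x \<le> y + 1"
      using that by (meson Max_ge Min_le add_le_mono1 le_trans)
  qed (use that in auto)
  have "(rows_labeled D i \<noteq> {} \<longrightarrow>
        Max (row_len D ` rows_labeled D i) \<le> Min (row_len D ` rows_labeled D i) + 1) \<longleftrightarrow>
      (\<forall>x\<in>#len_mset D i. \<forall>y\<in>#len_mset D i. x \<le> y + 1)" for i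
    unfolding set_mset_len_mset
    using *[of "row_len D ` rows_labeled D i"] by (cases "rows_labeled D i = {}") simp_all
  then show ?thesis unfolding cond4_def by simp
qed

lemma rows_labeled_outside:
  assumes "modular_diagram N k D" "i \<notin> {1..N}"
  shows "rows_labeled D i = {}"
  using modular_diagram_label[OF assms(1)] assms
  by (auto simp: rows_labeled_def modular_diagram_def)

lemma diagram_size_eq:
  assumes "modular_diagram N k D"
  shows "diagram_size D = (\<Sum>i = 1..N. label_sum D i)"
proof -
  have "row_label D ` {..<length D} \<subseteq> {1..N}"
    using modular_diagram_label[OF assms] assms by (auto simp: modular_diagram_def)
  then have "(\<Sum>i = 1..N. \<Sum>r | r \<in> {..<length D} \<and> row_label D r = i. row_len D r) =
      (\<Sum>r<length D. row_len D r)"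
    by (intro sum.group) auto
  then show ?thesis
    by (simp add: diagram_size_def label_sum_def rows_labeled_def)
qed

section \<open>The bijection between diagrams and families of sorted lists\<close>

context
  fixes lam :: "nat \<Rightarrow> nat" and a b :: nat
  assumes part: "is_partition lam"
begin

lemma diagram_size_block_sums:
  assumes "modular_diagram (lam 1) k D"
  shows "diagram_size D = (\<Sum>j = 1..num_parts lam. sum_list (block_sums lam D j))"
  unfolding diagram_size_eq[OF assms] sum_blocks[OF part] block_sums_def
    interv_sum_list_conv_sum_set_nat
  by (intro sum.cong) auto

text \<open>Condition (2) gives the order and bounds the largest label's sum, hence all sums of the
  block. By (1) and (3) each sum is over \<open>j\<close> rows of length at least
  \<open>lam j + lam (j + 1) - 1\<close>.\<close>

lemma block_sums_mem:
  assumes D: "D \<in> admissible a b lam" and j: "1 \<le> j"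
  shows "block_sums lam D j \<in> block_lists a lam j"
proof -
  let ?s = "label_sum D"
  have succ: "?s i \<le> ?s (i + 1)" if "lam (j + 1) < i" "i < lam j" for i
    using D that j by (simp add: admissible_def cond2_def)
  have mono: "?s i \<le> ?s i'" if "lam (j + 1) < i" "i \<le> i'" "i' \<le> lam j" for i i'
    using that(2,3,1)
  proof (induction i' rule: dec_induct)
    case (step i')
    then show ?case using succ[of i'] by simp
  qed simp
  have upper: "int (?s i) \<le> block_upper a lam j" if "lam (j + 1) < i" "i \<le> lam j" for i
  proof -
    have "int (?s (lam j)) \<le> block_upper a lam j"
      using D that j by (simp add: admissible_def cond2_def block_upper_def)
    then show ?thesis using mono[OF that(1,2) order_refl] by linarith
  qed
  have lower: "block_lower lam j \<le> ?s i" if i: "lam (j + 1) < i" "i \<le> lam j" for i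
  proof -
    have "1 \<le> i" using i by simp
    then have "card (rows_labeled D i) = j"
      using D conjugate_eq[OF part j i] by (simp add: admissible_def cond1_def)
    moreover have "lam j + lam (j + 1) - 1 \<le> row_len D r" if "r \<in> rows_labeled D i" for r
    proof -
      have "int (lam j) + int (lam (j + 1)) - 1 \<le> int (row_len D r)"
        using D that i j by (simp add: admissible_def cond3_def rows_labeled_def)
      then show ?thesis by linarith
    qed
    ultimately show ?thesis
      using sum_bounded_below[of "rows_labeled D i" "lam j + lam (j + 1) - 1" "row_len D"]
      by (simp add: label_sum_def block_lower_def)
  qed
  have "sorted (block_sums lam D j)"
    unfolding block_sums_def sorted_map sorted_wrt_iff_nth_less
    by (auto simp del: upt_Suc intro!: mono)
  then show ?thesis
    using lower upper by (auto simp: block_lists_def sorted_lists_def block_sums_def)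
qed

text \<open>Conditions (1) and (4) force each length multiset to be the balanced one, so the label
  sums determine the diagram.\<close>

lemma admissible_eqI:
  assumes D: "D \<in> admissible a b lam" and D': "D' \<in> admissible a b lam"
    and eq: "\<And>i. 1 \<le> i \<Longrightarrow> i \<le> lam 1 \<Longrightarrow> label_sum D i = label_sum D' i"
  shows "D = D'"
proof (rule modular_diagram_eqI)
  show m: "modular_diagram (lam 1) b D" "modular_diagram (lam 1) b D'"
    using D D' by (auto simp: admissible_def)
  have balanced: "len_mset E i = balanced (conjugate lam i) (label_sum E i)"
    if E: "E \<in> admissible a b lam" and i: "1 \<le> i" "i \<le> lam 1" for E i
  proof -
    have size: "size (len_mset E i) = conjugate lam i"
      using E i by (simp add: admissible_def cond1_def size_len_mset)
    then have "len_mset E i \<noteq> {#}" using conjugate_block(1)[OF part i] by auto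
    moreover have "x \<le> y + 1" if "x \<in># len_mset E i" "y \<in># len_mset E i" for x y
      using E that cond4_iff by (auto simp: admissible_def)
    ultimately show ?thesis
      using balanced_unique[of "len_mset E i"] unfolding size sum_mset_len_mset by blast
  qed
  show "len_mset D i = len_mset D' i" for i
  proof (cases "i \<in> {1..lam 1}")
    case True
    then show ?thesis using balanced[OF D] balanced[OF D'] eq by simp
  next
    case False
    then show ?thesis using rows_labeled_outside[OF m(1)] rows_labeled_outside[OF m(2)]
      by (simp add: len_mset_def)
  qed
qed

text \<open>Give label \<open>i\<close> the balanced multiset of size \<open>conjugate lam i\<close>
  and sum \<open>s i\<close>. Condition (4) holds by construction, and the bounds on
  \<open>s\<close> yield (3) and the rectangle.\<close>

lemma admissible_exists:
  assumes b: "partial_sum lam (num_parts lam) = b"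
    and mono: "\<And>j i. 1 \<le> j \<Longrightarrow> lam (j + 1) < i \<Longrightarrow> i < lam j \<Longrightarrow> s i \<le> s (i + 1)"
    and lower: "\<And>j i. 1 \<le> j \<Longrightarrow> lam (j + 1) < i \<Longrightarrow> i \<le> lam j \<Longrightarrow> block_lower lam j \<le> s i"
    and upper: "\<And>j i. 1 \<le> j \<Longrightarrow> lam (j + 1) < i \<Longrightarrow> i \<le> lam j \<Longrightarrow> int (s i) \<le> block_upper a lam j"
  obtains D where "D \<in> admissible a b lam" "\<And>i. 1 \<le> i \<Longrightarrow> i \<le> lam 1 \<Longrightarrow> label_sum D i = s i"
proof -
  define A where "A i = (if i \<in> {1..lam 1} then balanced (conjugate lam i) (s i) else {#})" for i
  have "A i = {#}" if "i \<notin> {1..lam 1}" for i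
    using that by (auto simp: A_def)
  then obtain D where D: "modular_diagram (lam 1) (\<Sum>i = 1..lam 1. size (A i)) D"
    and len: "\<And>i. len_mset D i = A i"
    using modular_diagram_exists[of "lam 1" A] by blast
  have "(\<Sum>i = 1..lam 1. size (A i)) = (\<Sum>i = 1..lam 1. conjugate lam i)"
    using conjugate_block(1)[OF part] by (intro sum.cong) (auto simp: A_def size_balanced Suc_le_eq)
  then have D: "modular_diagram (lam 1) b D"
    using D sum_conjugate[OF part] b by simp
  have sum: "label_sum D i = s i" if "1 \<le> i" "i \<le> lam 1" for i
    using conjugate_block(1)[OF part that] that
    by (simp add: A_def sum_mset_balanced Suc_le_eq len flip: sum_mset_len_mset)
  have row: "row_len D r \<in># balanced j (s (row_label D r))"
    if "r < length D" "1 \<le> j" "lam (j + 1) < row_label D r" "row_label D r \<le> lam j" for r j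
  proof -
    have "row_len D r \<in># len_mset D (row_label D r)"
      using that(1) by (auto simp: set_mset_len_mset rows_labeled_def)
    then show ?thesis
      using block_range[OF part that(2-)] conjugate_eq[OF part that(2-)] by (simp add: len A_def)
  qed
  have "row_len D r \<le> a" if r: "r < b" for r
  proof -
    let ?i = "row_label D r"
    let ?j = "conjugate lam ?i"
    have i: "1 \<le> ?i" "?i \<le> lam 1" using modular_diagram_label[OF D r] .
    note j = conjugate_block[OF part i]
    \<comment> \<open>The average length of the rows with this label is at most \<open>a\<close>,
      hence so is each balanced part.\<close>
    have "int (s ?i) \<le> int (?j * a)"
      using upper[OF j(1,3,4)] block_upper_le[OF part j(1)] j(3,4)
      by (meson le_less_trans less_le_trans order_trans)
    then have "s ?i \<le> ?j * a" by (simp only: of_nat_le_iff)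
    moreover have "r < length D" using D r by (simp add: modular_diagram_def)
    ultimately show ?thesis
      using balanced_le[OF row[OF _ j(1,3,4)]] j(1) by simp
  qed
  then have "contained_in_rect a b D"
    using D by (simp add: contained_in_rect_def modular_diagram_def)
  moreover have "cond1 lam D"
    unfolding cond1_def
  proof (intro allI impI)
    fix i :: nat assume i: "1 \<le> i"
    show "card (rows_labeled D i) = conjugate lam i"
    proof (cases "i \<le> lam 1")
      case True
      then show ?thesis using conjugate_block(1)[OF part i] i
        by (simp add: A_def size_balanced Suc_le_eq len flip: size_len_mset)
    next
      case False
      then have "conjugate lam i = 0" using le_conjugate_iff[OF part i, of 1] by simp
      then show ?thesis using False by (simp add: A_def len flip: size_len_mset)
    qed
  qed
  moreover have "cond2 a lam D"
    unfolding cond2_def block_upper_def[symmetric]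
  proof (intro allI impI conjI)
    fix j i assume j: "1 \<le> j" "lam (j + 1) < lam j" and i: "lam (j + 1) + 1 \<le> i \<and> i < lam j"
    then show "label_sum D i \<le> label_sum D (i + 1)"
      using mono[of j i] block_range[OF part j(1), of i] block_range[OF part j(1), of "i + 1"]
      by (simp add: sum)
  next
    fix j assume j: "1 \<le> j" "lam (j + 1) < lam j"
    then show "int (label_sum D (lam j)) \<le> block_upper a lam j"
      using upper[of j "lam j"] block_range[OF part j(1), of "lam j"] by (simp add: sum)
  qed
  moreover have "cond3 lam D"
    unfolding cond3_def
  proof (intro allI impI)
    fix j r assume j: "1 \<le> j" and r: "r < length D"
      and i: "lam (j + 1) + 1 \<le> row_label D r \<and> row_label D r \<le> lam j"
    have "j * (lam j + lam (j + 1) - 1) \<le> s (row_label D r)"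
      using lower[OF j] i by (simp add: block_lower_def)
    then have "lam j + lam (j + 1) - 1 \<le> row_len D r"
      using balanced_ge[OF row[OF r j]] i j by simp
    then show "int (lam j) + int (lam (j + 1)) - 1 \<le> int (row_len D r)" by linarith
  qed
  moreover have "cond4 D"
    unfolding cond4_iff len by (auto simp: A_def dest!: balanced_mem)
  ultimately have "D \<in> admissible a b lam" using D by (simp add: admissible_def)
  then show thesis using sum that by blast
qed

text \<open>The conditions on distinct blocks are independent, so the families form a full product.
  The map is restricted to the block indices to land in \<open>PiE\<close>.\<close>

lemma bij_betw_block_sums:
  assumes b: "partial_sum lam (num_parts lam) = b"
  shows "bij_betw (\<lambda>D. \<lambda>j\<in>{1..num_parts lam}. block_sums lam D j) (admissible a b lam)
    (PiE {1..num_parts lam} (block_lists a lam))"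
    (is "bij_betw ?f _ ?P")
proof (rule bij_betw_imageI)
  show "inj_on ?f (admissible a b lam)"
  proof (rule inj_onI)
    fix D D' assume D: "D \<in> admissible a b lam" "D' \<in> admissible a b lam" and eq: "?f D = ?f D'"
    show "D = D'"
    proof (rule admissible_eqI[OF D])
      fix i :: nat assume i: "1 \<le> i" "i \<le> lam 1"
      let ?j = "conjugate lam i"
      note j = conjugate_block[OF part i]
      have "block_sums lam D ?j = block_sums lam D' ?j"
        using fun_cong[OF eq, of ?j] j by simp
      then have "\<forall>i\<in>set [lam (?j + 1) + 1..<lam ?j + 1]. label_sum D i = label_sum D' i"
        by (simp only: block_sums_def map_eq_conv)
      moreover have "i \<in> set [lam (?j + 1) + 1..<lam ?j + 1]" using j by auto
      ultimately show "label_sum D i = label_sum D' i" by blast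
    qed
  qed
  show "?f ` admissible a b lam = ?P"
  proof (intro equalityI subsetI)
    fix g assume "g \<in> ?f ` admissible a b lam"
    then show "g \<in> ?P" using block_sums_mem by auto
  next
    fix g assume g: "g \<in> ?P"
    \<comment> \<open>Block \<open>j\<close> starts at label \<open>lam (j + 1) + 1\<close>, so
      label \<open>i\<close> sits at position \<open>i - lam (j + 1) - 1\<close> of its list, with
      \<open>j = conjugate lam i\<close>.\<close>
    define s where "s i = g (conjugate lam i) ! (i - lam (conjugate lam i + 1) - 1)" for i
    have block: "length (g j) = lam j - lam (j + 1) \<and> sorted (g j) \<and>
        set (g j) \<subseteq> {x. block_lower lam j \<le> x \<and> int x \<le> block_upper a lam j}"
      if "1 \<le> j" "j \<le> num_parts lam" for j
      using g that by (force simp: block_lists_def sorted_lists_def PiE_iff)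
    have s: "s i = g j ! (i - lam (j + 1) - 1)"
      if "1 \<le> j" "lam (j + 1) < i" "i \<le> lam j" for i j
      using conjugate_eq[OF part that] by (simp add: s_def)
    have mem: "block_lower lam j \<le> s i \<and> int (s i) \<le> block_upper a lam j"
      if "1 \<le> j" "lam (j + 1) < i" "i \<le> lam j" for i j
    proof -
      have "s i \<in> set (g j)"
        using block[OF that(1) block_range(3)[OF part that]] that by (simp add: s)
      then show ?thesis using block[OF that(1) block_range(3)[OF part that]] by blast
    qed
    have mono: "s i \<le> s (i + 1)" if "1 \<le> j" "lam (j + 1) < i" "i < lam j" for i j
    proof -
      have "j \<le> num_parts lam" using block_range(3)[OF part that(1,2)] that(3) by simp
      then have "sorted (g j)" "length (g j) = lam j - lam (j + 1)" using block that(1) by auto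
      then show ?thesis
        using s[OF that(1,2)] s[of j "i + 1"] that
        by (simp add: sorted_nth_mono)
    qed
    obtain D where D: "D \<in> admissible a b lam"
      and sum: "\<And>i. 1 \<le> i \<Longrightarrow> i \<le> lam 1 \<Longrightarrow> label_sum D i = s i"
      by (rule admissible_exists[where s = s, OF b]) (use mono mem in blast)+
    have "g = ?f D"
    proof
      fix j
      show "g j = ?f D j"
      proof (cases "j \<in> {1..num_parts lam}")
        case True
        then have "g j = block_sums lam D j"
          using block[of j] block_range[OF part, of j] s[of j]
          by (intro nth_equalityI) (simp_all add: block_sums_def sum del: upt_Suc)
        then show ?thesis using True by simp
      next
        case False
        then show ?thesis using g by (auto simp: PiE_iff extensional_def)
      qed
    qed
    then show "g \<in> ?f ` admissible a b lam" using D by blast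
  qed
qed

end

section \<open>Assembling the generating function\<close>

lemma size_gen_fun_finite:
  assumes "finite S"
  shows "size_gen_fun S = (\<Sum>D\<in>S. fps_X ^ diagram_size D)"
proof (rule fps_ext)
  fix n
  have "{D \<in> S. diagram_size D = n} = S \<inter> {D. n = diagram_size D}" by auto
  then show "fps_nth (size_gen_fun S) n = fps_nth (\<Sum>D\<in>S. fps_X ^ diagram_size D) n"
    using assms by (simp add: size_gen_fun_def fps_sum_nth sum.If_cases)
qed

theorem theorem3p2:
  fixes a b :: nat and lam :: "nat \<Rightarrow> nat"
  assumes "1 \<le> a" and "1 \<le> b"
    and "is_partition_of lam b"
  shows "F_poly a lam =
    size_gen_fun {D. modular_diagram (lam 1) b D \<and> contained_in_rect a b D \<and>
                     cond1 lam D \<and> cond2 a lam D \<and> cond3 lam D \<and> cond4 D}"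
proof -
  have part: "is_partition lam" and b: "partial_sum lam (num_parts lam) = b"
    using assms(3) by (simp_all add: is_partition_of_def)
  let ?J = "{1..num_parts lam}"
  let ?B = "block_lists a lam"
  note bij = bij_betw_block_sums[OF part b, of a]
  have finite_block: "finite (?B j)" for j
    unfolding block_lists_def
    by (rule finite_sorted_lists, rule finite_subset[of _ "{..nat (block_upper a lam j)}"]) auto
  \<comment> \<open>The product of the finite block sets is finite, and the bijection carries this
    over to the diagrams.\<close>
  then have finite: "finite (admissible a b lam)"
    using bij_betw_finite[OF bij] by (simp add: finite_PiE)
  have "(\<Prod>j\<in>?J. sum_gf (?B j)) = (\<Prod>j\<in>?J. fps_X ^ ((lam j - lam (j + 1)) * block_lower lam j) *
      gauss_poly (int j * (int a + 2) - int (partial_sum lam (j - 1)) - int (partial_sum lam (j + 1)))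
        (lam j - lam (j + 1)))"
    by (intro prod.cong refl sum_gf_block_lists[OF part]) auto
  \<comment> \<open>The powers of \<open>fps_X\<close> split off the blocks merge into the prefactor
    by \<open>sum_block_lower\<close>.\<close>
  then have "F_poly a lam = (\<Prod>j\<in>?J. sum_gf (?B j))"
    by (simp only: F_poly_def prod.distrib power_sum[symmetric] sum_block_lower[OF part])
  \<comment> \<open>Expanding the product of sums chooses one list per block.\<close>
  also have "\<dots> = (\<Sum>g\<in>PiE ?J ?B. \<Prod>j\<in>?J. fps_X ^ sum_list (g j))"
    unfolding sum_gf_def using finite_block by (intro prod_sum_PiE) auto
  also have "\<dots> = (\<Sum>D\<in>admissible a b lam. \<Prod>j\<in>?J. fps_X ^ sum_list (block_sums lam D j))"
    by (subst sum.reindex_bij_betw[OF bij, symmetric]) simp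
  also have "\<dots> = (\<Sum>D\<in>admissible a b lam. fps_X ^ diagram_size D)"
    by (intro sum.cong refl, subst diagram_size_block_sums[OF part])
      (auto simp: admissible_def power_sum)
  also have "\<dots> = size_gen_fun (admissible a b lam)"
    by (rule size_gen_fun_finite[OF finite, symmetric])
  finally show ?thesis by (simp only: admissible_def)
qed

end
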